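(* Assume $\int_0^1 t\,p(t)\,dt=+\infty$ and let $C\in\mathbb{R}$. Then the inequality boundary value problem $$-\Delta u+C|\nabla u|^2\ge p(d(x))g(u)\ \text{in }\Omega,\qquad u>0\ \text{in }\Omega,\qquad u=0\ \text{on }\partial\Omega$$ has no classical solution $u\in C^2(\Omega)\cap C(\overline{\Omega})$.
   Context: $\Omega\subset\mathbb{R}^N$ ($N\ge 2$) is a bounded domain with smooth boundary and $d(x)=\operatorname{dist}(x,\partial\Omega)$. The function $g\in C^1(0,\infty)$ is positive and decreasing with $\lim_{t\to0^+}g(t)=+\infty$. The function $p:(0,+\infty)\to(0,+\infty)$ is nonincreasing and Hölder continuous. *)

theory Defs
  imports "HOL-Analysis.Analysis"
begin

definition pderiv_dir :: "('a::euclidean_space \<Rightarrow> real) \<Rightarrow> 'a \<Rightarrow> 'a \<Rightarrow> real" where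
  "pderiv_dir f i x = frechet_derivative f (at x) i"

fun Ck_on :: "nat \<Rightarrow> 'a::euclidean_space set \<Rightarrow> ('a \<Rightarrow> real) \<Rightarrow> bool" where
  "Ck_on 0 S f = continuous_on S f"
| "Ck_on (Suc k) S f = (continuous_on S f \<and> f differentiable_on S \<and>
      (\<forall>i\<in>Basis. Ck_on k S (pderiv_dir f i)))"

definition Cinf_on :: "'a::euclidean_space set \<Rightarrow> ('a \<Rightarrow> real) \<Rightarrow> bool" where
  "Cinf_on S f = (\<forall>k. Ck_on k S f)"

definition grad :: "('a::euclidean_space \<Rightarrow> real) \<Rightarrow> 'a \<Rightarrow> 'a" where
  "grad f x = (\<Sum>i\<in>Basis. pderiv_dir f i x *\<^sub>R i)"

definition laplacian :: "('a::euclidean_space \<Rightarrow> real) \<Rightarrow> 'a \<Rightarrow> real" where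
  "laplacian f x = (\<Sum>i\<in>Basis. pderiv_dir (pderiv_dir f i) i x)"

definition bounded_domain :: "'a::euclidean_space set \<Rightarrow> bool" where
  "bounded_domain \<Omega> = (\<Omega> \<noteq> {} \<and> open \<Omega> \<and> connected \<Omega> \<and> bounded \<Omega>)"

definition smooth_boundary :: "'a::euclidean_space set \<Rightarrow> bool" where
  "smooth_boundary \<Omega> = (\<forall>z\<in>frontier \<Omega>. \<exists>U \<phi>. open U \<and> z \<in> U \<and> Cinf_on U \<phi> \<and>
      (\<forall>x\<in>U. grad \<phi> x \<noteq> 0) \<and> \<Omega> \<inter> U = {x\<in>U. \<phi> x < 0})"

definition loc_holder_pos :: "(real \<Rightarrow> real) \<Rightarrow> bool" where
  "loc_holder_pos p = (\<exists>\<alpha>. 0 < \<alpha> \<and> \<alpha> \<le> 1 \<and> (\<forall>a b. 0 < a \<longrightarrow> a \<le> b \<longrightarrow>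
      (\<exists>L. \<forall>s\<in>{a..b}. \<forall>t\<in>{a..b}. \<bar>p s - p t\<bar> \<le> L * \<bar>s - t\<bar> powr \<alpha>)))"

end

theory Submission
  imports Defs
begin

text \<open>
  Enlarging \<open>C\<close> we may take \<open>C > 0\<close>; then \<open>v = 1 - exp (- C u)\<close> is bounded, positive and satisfies
  \<open>- \<Delta>v \<ge> \<epsilon> p(d)\<close>. Near a boundary point let \<open>\<rho>\<close> be a smooth function that is positive inside, vanishes
  on the boundary and dominates \<open>d\<close>, and let \<open>Q'' = p\<close>, \<open>Q(s) = \<integral>\<^sub>s\<^sup>1 \<integral>\<^sub>t\<^sup>2 p\<close>. The divergence of
  \<open>\<integral> t p(t) dt\<close> means \<open>Q(0+) = \<infinity>\<close>, and monotonicity of \<open>p\<close> gives \<open>\<bar>Q'\<bar> \<le> 2 p\<close>, so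
  \<open>\<bar>\<Delta>(Q \<circ> \<rho>)\<bar>\<close> is at most a multiple of \<open>p(\<rho>) \<le> p(d)\<close>. Hence for small \<open>\<delta> > 0\<close> the function
  \<open>v + \<delta> Q(\<rho>)\<close> is superharmonic near that point and blows up along the boundary.
  Compare it on a ball \<open>B(y, R)\<close>, with \<open>y\<close> just outside the domain, with arbitrarily large multiples
  of the strictly subharmonic \<open>exp (- k \<bar>x - y\<bar>\<^sup>2) - exp (- k R\<^sup>2)\<close>, which vanishes on the sphere: the
  superharmonic function would have to be infinite.
\<close>

section \<open>One-variable calculus and the blow-up profile\<close>

lemma second_deriv_nonneg_at_min:
  fixes f f1 :: "real \<Rightarrow> real"
  assumes e: "0 < e" and d: "\<And>t. \<bar>t\<bar> < e \<Longrightarrow> (f has_real_derivative f1 t) (at t)"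
    and d2: "(f1 has_real_derivative D) (at 0)"
    and m: "\<And>t. \<bar>t\<bar> < e \<Longrightarrow> f 0 \<le> f t"
  shows "0 \<le> D"
proof (rule ccontr)
  assume "\<not> 0 \<le> D"
  have f10: "f1 0 = 0"
    using DERIV_local_min[OF d[of 0] e] m e by auto
  obtain r where r: "0 < r" "\<And>h. 0 < h \<Longrightarrow> h < r \<Longrightarrow> f1 h < 0"
    using DERIV_neg_dec_right[OF d2] \<open>\<not> 0 \<le> D\<close> f10 by auto
  \<comment> \<open>\<open>f1\<close> vanishes at the interior minimum and is negative just to its
    right when \<open>D\<close> is negative; the mean value theorem then puts \<open>f h\<close>
    below the minimum.\<close>
  define h where "h = min e r / 2"
  have h: "0 < h" "h < e" "h < r" using e r(1) by (auto simp: h_def)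
  obtain z where z: "0 < z" "z < h" "f h - f 0 = (h - 0) * f1 z"
    using MVT2[OF h(1), of f f1] d h by force
  have "f1 z < 0" using r(2)[of z] z h by auto
  then have "f h < f 0" using z(3) h(1) by (smt (verit) mult_pos_neg)
  then show False using m[of h] h by auto
qed

lemma continuous_on_loc_holder_pos:
  assumes "loc_holder_pos p"
  shows "continuous_on {0<..} p"
proof (rule continuous_at_imp_continuous_on, rule ballI)
  fix x :: real assume "x \<in> {0<..}"
  then have x: "x > 0" by simp
  obtain \<alpha> where al: "0 < \<alpha>" and H: "\<forall>a b. 0 < a \<longrightarrow> a \<le> b \<longrightarrow>
      (\<exists>L. \<forall>s\<in>{a..b}. \<forall>t\<in>{a..b}. \<bar>p s - p t\<bar> \<le> L * \<bar>s - t\<bar> powr \<alpha>)"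
    using assms unfolding loc_holder_pos_def by blast
  obtain L where L: "\<And>s t. s\<in>{x/2..2*x} \<Longrightarrow> t\<in>{x/2..2*x} \<Longrightarrow> \<bar>p s - p t\<bar> \<le> L * \<bar>s - t\<bar> powr \<alpha>"
    using H[rule_format, of "x/2" "2*x"] x by fastforce
  have "((\<lambda>s. L * \<bar>s - x\<bar> powr \<alpha>) \<longlongrightarrow> L * 0) (at x)"
    by (intro tendsto_mult tendsto_const tendsto_zero_powrI[where b=\<alpha>] al)
       (auto intro!: tendsto_eq_intros al)
  moreover have "eventually (\<lambda>s. s \<in> {x/2<..<2*x}) (at x)"
    using x by (intro eventually_at_in_open') auto
  then have "eventually (\<lambda>s. norm (p s - p x) \<le> L * \<bar>s - x\<bar> powr \<alpha>) (at x)"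
    by eventually_elim (use L x in auto)
  ultimately have "((\<lambda>s. p s - p x) \<longlongrightarrow> 0) (at x)"
    by (intro Lim_null_comparison[of "\<lambda>s. p s - p x" "\<lambda>s. L * \<bar>s - x\<bar> powr \<alpha>"]) auto
  then show "isCont p x" using Lim_null isCont_def by blast
qed

text \<open>Near \<open>s\<close> the integral is a fixed one over \<open>{s/2..b}\<close> minus one
  with variable upper limit, so the usual fundamental theorem applies. The base point
  \<open>s/2\<close> stays away from 0, where \<open>f\<close> may be singular.\<close>

lemma has_real_derivative_integral_left:
  fixes f :: "real \<Rightarrow> real"
  assumes c: "continuous_on {0<..b} f" and s: "0 < s" "s < b"
  shows "((\<lambda>s. integral {s..b} f) has_real_derivative - f s) (at s)"
proof -
  have cc: "continuous_on {s/2..b} f"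
    by (rule continuous_on_subset[OF c]) (use s in auto)
  have "((\<lambda>x. integral {s/2..x} f) has_real_derivative f s) (at s within {s/2..b})"
    by (rule integral_has_real_derivative[OF cc]) (use s in auto)
  then have "((\<lambda>x. integral {s/2..x} f) has_real_derivative f s) (at s)"
    using s by (simp add: at_within_Icc_at)
  then have "((\<lambda>x. integral {s/2..b} f - integral {s/2..x} f) has_real_derivative - f s) (at s)"
    by (auto intro!: derivative_eq_intros)
  moreover have "eventually (\<lambda>x. x \<in> {s/2<..<b}) (nhds s)"
    using s by (intro eventually_nhds_in_open) auto
  then have "eventually (\<lambda>x. integral {s/2..b} f - integral {s/2..x} f = integral {x..b} f) (nhds s)"
  proof eventually_elim
    case (elim x)
    have "integral {s/2..x} f + integral {x..b} f = integral {s/2..b} f"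
      using elim cc by (intro Henstock_Kurzweil_Integration.integral_combine integrable_continuous_interval) auto
    then show ?case by simp
  qed
  ultimately show ?thesis by (simp only: DERIV_cong_ev[OF refl _ refl])
qed

text \<open>\<open>Q\<close> is the profile composed later with the boundary function. The bound on
  \<open>Q1\<close> makes the first-order part of the Laplacian of the composition comparable to the
  part containing \<open>p\<close>. The last property is all that is needed of the blow-up: large
  values at arbitrarily small arguments.\<close>

lemma blowup_function:
  fixes p :: "real \<Rightarrow> real"
  assumes pos: "\<And>t. 0 < t \<Longrightarrow> 0 < p t" and dec: "\<And>s t. 0 < s \<Longrightarrow> s \<le> t \<Longrightarrow> p t \<le> p s"
    and cont: "continuous_on {0<..} p"
    and inf: "(\<integral>\<^sup>+ t. ennreal (t * p t) * indicator {0<..1} t \<partial>lborel) = \<infinity>"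
  obtains Q Q1 :: "real \<Rightarrow> real" where
    "\<And>s. 0 < s \<Longrightarrow> s < 1 \<Longrightarrow> (Q has_real_derivative - Q1 s) (at s)"
    "\<And>s. 0 < s \<Longrightarrow> s < 1 \<Longrightarrow> (Q1 has_real_derivative - p s) (at s)"
    "\<And>s. 0 < s \<Longrightarrow> s < 1 \<Longrightarrow> 0 \<le> Q s"
    "\<And>s. 0 < s \<Longrightarrow> s < 1 \<Longrightarrow> 0 \<le> Q1 s"
    "\<And>s. 0 < s \<Longrightarrow> s < 1 \<Longrightarrow> Q1 s \<le> 2 * p s"
    "\<And>B e. 0 < e \<Longrightarrow> \<exists>s. 0 < s \<and> s < e \<and> s < 1 \<and> B \<le> Q s"
proof -
  \<comment> \<open>The upper limit 2 makes \<open>Q1\<close> differentiable also at 1, hence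
    continuous on \<open>{0<..1}\<close>, as the definition of \<open>Q\<close> requires.\<close>
  define Q1 where "Q1 s = integral {s..2} p" for s
  define Q where "Q s = integral {s..1} Q1" for s
  have Q1d: "(Q1 has_real_derivative - p s) (at s)" if "0 < s" "s < 2" for s
    unfolding Q1_def
    by (rule has_real_derivative_integral_left) (use that in \<open>auto intro: continuous_on_subset[OF cont]\<close>)
  have Q1c: "continuous_on {0<..1} Q1"
    by (intro continuous_at_imp_continuous_on ballI DERIV_isCont[OF Q1d]) auto
  have Qd: "(Q has_real_derivative - Q1 s) (at s)" if "0 < s" "s < 1" for s
    unfolding Q_def
    by (rule has_real_derivative_integral_left) (use that Q1c in auto)
  have Q1_nonneg: "0 \<le> Q1 s" if "0 < s" for s
    unfolding Q1_def
  proof (rule Henstock_Kurzweil_Integration.integral_nonneg)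
    show "p integrable_on {s..2}"
      by (intro integrable_continuous_interval continuous_on_subset[OF cont]) (use that in auto)
    show "0 \<le> p x" if "x \<in> {s..2}" for x
      using pos[of x] that \<open>0 < s\<close> by auto
  qed
  have Q_nonneg: "0 \<le> Q s" if "0 < s" for s
    unfolding Q_def
  proof (rule Henstock_Kurzweil_Integration.integral_nonneg)
    show "Q1 integrable_on {s..1}"
      by (intro integrable_continuous_interval continuous_on_subset[OF Q1c]) (use that in auto)
    show "0 \<le> Q1 x" if "x \<in> {s..1}" for x
      using Q1_nonneg[of x] that \<open>0 < s\<close> by auto
  qed
  have Q1_le: "Q1 s \<le> 2 * p s" if "0 < s" "s < 1" for s
  proof -
    have "Q1 s \<le> integral {s..2} (\<lambda>_. p s)"
      unfolding Q1_def
      by (intro integral_le integrable_continuous_interval continuous_on_subset[OF cont] continuous_on_const)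
         (use that dec in auto)
    also have "\<dots> = (2 - s) * p s" using that by simp
    also have "\<dots> \<le> 2 * p s" using that pos[of s] by (intro mult_right_mono) auto
    finally show ?thesis .
  qed
  have unbdd: "\<exists>s. 0 < s \<and> s < e \<and> s < 1 \<and> B \<le> Q s" if e: "0 < e" for B e
  proof (rule ccontr)
    assume "\<not> ?thesis"
    then have B: "Q s < B" if "0 < s" "s < e" "s < 1" for s using that by force
    define b where "b = min e 1 / 2"
    have b: "0 < b" "b < e" "b < 1" using e by (auto simp: b_def)
    \<comment> \<open>Since \<open>(- t Q\<^sub>1 - Q)' = t p\<close>, bounds on \<open>Q\<close> and \<open>t Q\<^sub>1\<close> near 0 would make \<open>\<integral> t p(t) dt\<close> converge.\<close>
    have bound: "s * Q1 s \<le> 2 * B" if s: "0 < s" "s \<le> b" for s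
    proof -
      \<comment> \<open>\<open>Q1\<close> is nonincreasing, so the drop of \<open>Q\<close> over
        \<open>{s/2..s}\<close> is at least \<open>s/2 * Q1 s\<close>. A bound on \<open>Q\<close>
        therefore controls \<open>s * Q1 s\<close>.\<close>
      obtain z where z: "s/2 < z" "z < s" "Q s - Q (s/2) = (s - s/2) * (- Q1 z)"
      proof -
        have "\<exists>z. s/2 < z \<and> z < s \<and> Q s - Q (s/2) = (s - s/2) * (- Q1 z)"
          by (rule MVT2) (use s b in \<open>auto intro!: Qd\<close>)
        then show ?thesis using that by blast
      qed
      have "\<exists>y. (Q1 has_real_derivative y) (at x) \<and> y \<le> 0" if "z \<le> x" "x \<le> s" for x
        using Q1d[of x] pos[of x] that z s b by (intro exI[of _ "- p x"]) auto
      then have "Q1 s \<le> Q1 z"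
        using DERIV_nonpos_imp_nonincreasing[OF less_imp_le[OF z(2)]] by blast
      then have "s / 2 * Q1 s \<le> s / 2 * Q1 z" using s by auto
      also have "\<dots> = Q (s/2) - Q s" using z(3) by simp
      also have "\<dots> \<le> B" using B[of "s/2"] Q_nonneg[of s] s b by auto
      finally show ?thesis by simp
    qed
    \<comment> \<open>The indicator makes the integrand Borel on the whole line; nothing is known
      about \<open>p\<close> at nonpositive arguments.\<close>
    define f where "f t = indicator {0<..} t *\<^sub>R (t * p t)" for t
    have fm [measurable]: "f \<in> borel_measurable borel"
      unfolding f_def by (rule borel_measurable_continuous_on_indicator) (auto intro!: continuous_intros cont)
    have part: "(\<integral>\<^sup>+t. ennreal (f t) * indicator {s..b} t \<partial>lborel) \<le> ennreal (3 * B)"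
      if s: "0 < s" "s \<le> b" for s
    proof -
      let ?G = "\<lambda>t. - t * Q1 t - Q t"
      have "(\<integral>\<^sup>+t. ennreal (f t) * indicator {s..b} t \<partial>lborel) = ennreal (?G b - ?G s)"
      proof (rule nn_integral_FTC_Icc)
        fix t assume t: "t \<in> {s..b}"
        show "(?G has_real_derivative f t) (at t)"
          by (rule derivative_eq_intros Q1d Qd refl | use s t b in \<open>simp add: f_def\<close>)+
        show "0 \<le> f t" using s t pos[of t] by (simp add: f_def)
      qed (use s in auto)
      also have "\<dots> \<le> ennreal (3 * B)"
      proof (rule ennreal_leI)
        have "0 \<le> b * Q1 b" using Q1_nonneg[of b] b by simp
        moreover have "s * Q1 s \<le> 2 * B" "Q s < B" "0 \<le> Q b"
          using bound[of s] B[of s] Q_nonneg[of b] b s by auto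
        ultimately show "?G b - ?G s \<le> 3 * B" by linarith
      qed
      finally show ?thesis .
    qed
    \<comment> \<open>Exhaust \<open>{0<..b}\<close> by closed intervals off the singularity, so
      that monotone convergence carries the uniform bound \<open>part\<close> to the limit.\<close>
    define h where "h n = (\<lambda>t. ennreal (f t) * indicator {b / real (Suc n)..b} t)" for n :: nat
    have hmono: "incseq h"
    proof (intro incseq_SucI le_funI)
      fix n t
      have "b / real (Suc (Suc n)) \<le> b / real (Suc n)"
        using b by (intro divide_left_mono) auto
      then show "h n t \<le> h (Suc n) t"
        by (auto simp: h_def split: split_indicator)
    qed
    have hsup: "(SUP n. h n t) = ennreal (f t) * indicator {0<..b} t" for t
    proof (cases "t \<in> {0<..b}")
      case True
      obtain n :: nat where "b / t < real n" using reals_Archimedean2 by blast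
      then have "b / t \<le> real (Suc n)" by simp
      then have "b / real (Suc n) \<le> t" using True by (simp add: field_simps)
      then have "h n t = ennreal (f t)" using True by (simp add: h_def)
      moreover have "h m t \<le> ennreal (f t)" for m by (auto simp: h_def split: split_indicator)
      ultimately show ?thesis using True
        by (intro antisym SUP_least) (auto intro: SUP_upper2[of n])
    next
      case False
      have "h n t = 0" for n
      proof -
        have "0 < b / real (Suc n)" using b by simp
        then have "t \<notin> {b / real (Suc n)..b}" using False by auto
        then show ?thesis by (simp add: h_def)
      qed
      then show ?thesis using False by simp
    qed
    have "(\<integral>\<^sup>+t. ennreal (f t) * indicator {0<..b} t \<partial>lborel) = (\<integral>\<^sup>+t. (SUP n. h n t) \<partial>lborel)"
      by (simp add: hsup)
    also have "\<dots> = (SUP n. integral\<^sup>N lborel (h n))"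
      by (rule nn_integral_monotone_convergence_SUP[OF hmono]) (unfold h_def, measurable)
    also have "\<dots> \<le> ennreal (3 * B)"
      unfolding h_def using b by (intro SUP_least part) (auto simp: field_simps)
    finally have 1: "(\<integral>\<^sup>+t. ennreal (f t) * indicator {0<..b} t \<partial>lborel) \<le> ennreal (3 * B)" .
    \<comment> \<open>Beyond \<open>b\<close> the integrand is at most \<open>p b\<close>, so only
      the part near 0 could be infinite.\<close>
    have "(\<integral>\<^sup>+ t. ennreal (t * p t) * indicator {0<..1} t \<partial>lborel)
        \<le> (\<integral>\<^sup>+ t. ennreal (f t) * indicator {0<..b} t + ennreal (p b) * indicator {0..1} t \<partial>lborel)"
    proof (rule nn_integral_mono)
      fix t :: real
      have "t * p t \<le> 1 * p b" if "b < t" "t \<le> 1"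
        using that b dec[of b t] pos[of t] by (intro mult_mono) auto
      then show "ennreal (t * p t) * indicator {0<..1} t
          \<le> ennreal (f t) * indicator {0<..b} t + ennreal (p b) * indicator {0..1} t"
        using b by (auto simp: f_def intro: ennreal_leI split: split_indicator)
    qed
    also have "\<dots> = (\<integral>\<^sup>+ t. ennreal (f t) * indicator {0<..b} t \<partial>lborel) + ennreal (p b)"
      by (subst nn_integral_add) (auto simp: nn_integral_cmult_indicator)
    also have "\<dots> < \<infinity>" using 1 by (auto simp: less_top[symmetric] top_unique)
    finally show False using inf by simp
  qed
  show thesis
    by (rule that[of Q Q1]) (use Qd Q1d Q_nonneg Q1_nonneg Q1_le unbdd in auto)
qed

section \<open>Pointwise tools for continuous and twice differentiable functions\<close>

lemma eventually_nhds_isCont_gt: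
  fixes f :: "'a::t2_space \<Rightarrow> 'b::order_topology"
  assumes "isCont f z" "a < f z"
  shows "eventually (\<lambda>x. a < f x) (nhds z)"
  using order_tendstoD(1)[OF iffD1[OF tendsto_at_iff_tendsto_nhds assms(1)[unfolded isCont_def]] assms(2)] .

text \<open>The Laplacian is handled one coordinate line at a time. By linearity of the Frechet
  derivative and the chain rule, \<open>pderiv_dir\<close> is the ordinary derivative of the slice
  along such a line.\<close>

lemma Ck_on_2_derivatives:
  fixes f :: "'a::euclidean_space \<Rightarrow> real"
  assumes f: "Ck_on 2 S f" and S: "open S" and i: "i \<in> Basis" and x: "x + t *\<^sub>R i \<in> S"
  shows "((\<lambda>t. f (x + t *\<^sub>R i)) has_real_derivative pderiv_dir f i (x + t *\<^sub>R i)) (at t)"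
    and "((\<lambda>t. pderiv_dir f i (x + t *\<^sub>R i)) has_real_derivative
           pderiv_dir (pderiv_dir f i) i (x + t *\<^sub>R i)) (at t)"
proof -
  have *: "((\<lambda>t. h (x + t *\<^sub>R i)) has_real_derivative pderiv_dir h i (x + t *\<^sub>R i)) (at t)"
    if h: "h differentiable_on S" for h :: "'a \<Rightarrow> real"
  proof -
    have "h differentiable (at (x + t *\<^sub>R i))"
      using h x S by (simp add: differentiable_on_eq_differentiable_at)
    then have D: "(h has_derivative frechet_derivative h (at (x + t *\<^sub>R i))) (at (x + t *\<^sub>R i))"
      by (simp add: frechet_derivative_works)
    have "((\<lambda>t. x + t *\<^sub>R i) has_derivative (\<lambda>s. s *\<^sub>R i)) (at t)"
      by (auto intro!: derivative_eq_intros)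
    from has_derivative_compose[OF this D]
    have "((\<lambda>t. h (x + t *\<^sub>R i)) has_derivative
        (\<lambda>s. frechet_derivative h (at (x + t *\<^sub>R i)) (s *\<^sub>R i))) (at t)" .
    moreover have "frechet_derivative h (at (x + t *\<^sub>R i)) (s *\<^sub>R i) = pderiv_dir h i (x + t *\<^sub>R i) * s" for s
      using linear_scale[OF has_derivative_linear[OF D]] by (simp add: pderiv_dir_def)
    ultimately show ?thesis by (simp add: has_field_derivative_def)
  qed
  show "((\<lambda>t. f (x + t *\<^sub>R i)) has_real_derivative pderiv_dir f i (x + t *\<^sub>R i)) (at t)"
    and "((\<lambda>t. pderiv_dir f i (x + t *\<^sub>R i)) has_real_derivative
           pderiv_dir (pderiv_dir f i) i (x + t *\<^sub>R i)) (at t)"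
    using f i by (auto intro!: * simp: numeral_2_eq_2)
qed

lemma Ck_on_2_continuous:
  assumes "Ck_on 2 S f" "i \<in> Basis"
  shows "continuous_on S f" "continuous_on S (pderiv_dir f i)"
    "continuous_on S (pderiv_dir (pderiv_dir f i) i)"
  using assms by (auto simp: numeral_2_eq_2)

lemma norm_grad_squared: "(norm (grad f x))\<^sup>2 = (\<Sum>i\<in>Basis. (pderiv_dir f i x)\<^sup>2)"
proof -
  have "grad f x \<bullet> i = pderiv_dir f i x" if "i \<in> Basis" for i
    using that by (simp add: grad_def)
  then show ?thesis
    unfolding power2_norm_eq_inner by (subst euclidean_inner) (simp add: power2_eq_square)
qed

section \<open>Geometry near a boundary point\<close>

lemma infdist_frontier_le:
  fixes x e :: "'a::euclidean_space"
  assumes x: "x \<in> \<Omega>" and y: "x + t *\<^sub>R e \<notin> \<Omega>" and t: "0 \<le> t" and e: "norm e = 1"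
  shows "infdist x (frontier \<Omega>) \<le> t"
proof -
  \<comment> \<open>A segment that leaves the set must cross its frontier.\<close>
  have "closed_segment x (x + t *\<^sub>R e) \<inter> frontier \<Omega> \<noteq> {}"
    using x y by (intro connected_Int_frontier) auto
  then obtain w where w: "w \<in> closed_segment x (x + t *\<^sub>R e)" "w \<in> frontier \<Omega>" by auto
  have "infdist x (frontier \<Omega>) \<le> dist x w" by (rule infdist_le[OF w(2)])
  also have "\<dots> \<le> dist x (x + t *\<^sub>R e)" 
    using dist_in_closed_segment[OF w(1)] by (simp add: dist_commute)
  also have "\<dots> = t" using t e by (simp add: dist_norm)
  finally show ?thesis .
qed

text \<open>The function \<rho> of the outline is \<open>- c * \<phi>\<close>. Some axis direction
  increases \<phi> at a rate above \<open>m\<close> near \<open>z\<close>; walking along it from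
  \<open>x\<close> for the length \<open>- \<phi> x / m\<close> leaves \<Omega>, so this length
  bounds the distance to the boundary. This gives \<open>c = 1 / m\<close>. The centre
  \<open>y\<close> is reached from \<open>z\<close> by a short step in the same direction.\<close>

lemma local_boundary_function:
  fixes \<Omega> :: "'a::euclidean_space set"
  assumes op: "open \<Omega>" and sm: "smooth_boundary \<Omega>" and z: "z \<in> frontier \<Omega>"
  obtains U \<phi> c y R \<eta> where
    "open U" "Ck_on 2 U \<phi>" "\<Omega> \<inter> U = {x \<in> U. \<phi> x < 0}"
    "cball y R \<subseteq> U" "\<Omega> \<inter> ball y R \<noteq> {}" "0 < \<eta>" "\<Omega> \<inter> ball y \<eta> = {}" "0 < c"
    "\<And>x. x \<in> \<Omega> \<inter> cball y R \<Longrightarrow> - c * \<phi> x < 1"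
    "\<And>x. x \<in> \<Omega> \<inter> cball y R \<Longrightarrow> infdist x (frontier \<Omega>) \<le> - c * \<phi> x"
proof -
  obtain U \<phi> where U: "open U" "z \<in> U" and C: "Cinf_on U \<phi>" and gr: "grad \<phi> z \<noteq> 0"
    and \<Omega>: "\<Omega> \<inter> U = {x \<in> U. \<phi> x < 0}"
    using sm z unfolding smooth_boundary_def by blast
  have mem: "x \<in> \<Omega> \<longleftrightarrow> \<phi> x < 0" if "x \<in> U" for x
    using \<Omega> that by blast
  have C2: "Ck_on 2 U \<phi>" using C by (simp add: Cinf_on_def)
  obtain j where j: "j \<in> Basis" "pderiv_dir \<phi> j z \<noteq> 0"
    using gr unfolding grad_def by (metis (no_types, lifting) scale_eq_0_iff sum.neutral)
  \<comment> \<open>The sign \<sigma> orients the axis so that \<phi> increases; halving the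
    derivative in \<open>m\<close> leaves room for a strict bound in a neighbourhood.\<close>
  define \<sigma> where "\<sigma> = sgn (pderiv_dir \<phi> j z)"
  define m where "m = \<bar>pderiv_dir \<phi> j z\<bar> / 2"
  have m: "0 < m" using j by (simp add: m_def)
  have \<sigma>: "\<bar>\<sigma>\<bar> = 1" "\<sigma> * \<sigma> = 1" using j by (auto simp: \<sigma>_def sgn_if)
  have mz: "m < \<sigma> * pderiv_dir \<phi> j z" using j by (auto simp: m_def \<sigma>_def sgn_if)
  note cont = Ck_on_2_continuous[OF C2 j(1)]
  have "isCont (\<lambda>x. \<sigma> * pderiv_dir \<phi> j x) z"
    using cont(2) U by (auto intro!: continuous_intros simp: continuous_on_eq_continuous_at)
  then have "eventually (\<lambda>x. m < \<sigma> * pderiv_dir \<phi> j x) (nhds z)"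
    using mz eventually_nhds_isCont_gt by blast
  then have "eventually (\<lambda>x. m < \<sigma> * pderiv_dir \<phi> j x \<and> x \<in> U) (nhds z)"
    using U eventually_nhds_in_open eventually_conj by blast
  then obtain r where r: "0 < r" and rU: "\<And>x. dist x z < r \<Longrightarrow> m < \<sigma> * pderiv_dir \<phi> j x \<and> x \<in> U"
    unfolding eventually_nhds_metric by blast
  have phi_cont: "isCont \<phi> w" if "w \<in> U" for w
    using cont(1) U that by (auto simp: continuous_on_eq_continuous_at)
  have z_cl: "z \<in> closure \<Omega>" and z_nin: "z \<notin> \<Omega>"
    using z op by (auto simp: frontier_def interior_open)
  have phi_pos_nhd: "\<exists>\<eta>>0. \<Omega> \<inter> ball w \<eta> = {}" if w: "w \<in> U" "0 < \<phi> w" for w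
  proof -
    have "eventually (\<lambda>x. 0 < \<phi> x) (nhds w)"
      using phi_cont[OF w(1)] w(2) eventually_nhds_isCont_gt by blast
    then have "eventually (\<lambda>x. 0 < \<phi> x \<and> x \<in> U) (nhds w)"
      using U w eventually_nhds_in_open eventually_conj by blast
    then obtain \<eta> where "0 < \<eta>" and \<eta>: "\<And>x. dist x w < \<eta> \<Longrightarrow> 0 < \<phi> x \<and> x \<in> U"
      unfolding eventually_nhds_metric by blast
    have "x \<notin> \<Omega>" if "x \<in> ball w \<eta>" for x
      using \<eta>[of x] that mem[of x] by (auto simp: dist_commute)
    then show ?thesis using \<open>0 < \<eta>\<close> by blast
  qed
  \<comment> \<open>A negative value would put \<open>z\<close> in \<Omega>, a positive one would
    keep \<Omega> away from \<open>z\<close>.\<close>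
  have phi_z: "\<phi> z = 0"
  proof -
    have "\<phi> z \<ge> 0" using z_nin mem U by force
    moreover have "\<not> 0 < \<phi> z"
    proof
      assume "0 < \<phi> z"
      then obtain \<eta> where "\<eta> > 0" "\<Omega> \<inter> ball z \<eta> = {}" using phi_pos_nhd U by blast
      then show False using z_cl by (metis Int_commute centre_in_ball disjoint_iff open_Int_closure_eq_empty open_ball)
    qed
    ultimately show ?thesis by simp
  qed
  have grow: "m * t < \<phi> (x + t *\<^sub>R (\<sigma> *\<^sub>R j)) - \<phi> x" if x: "dist x z + t < r" and t: "0 < t" for x t
  proof -
    have in_r: "dist (x + s *\<^sub>R (\<sigma> *\<^sub>R j)) z < r" if s: "0 \<le> s" "s \<le> t" for s
    proof -
      have "dist (x + s *\<^sub>R (\<sigma> *\<^sub>R j)) z \<le> dist (x + s *\<^sub>R (\<sigma> *\<^sub>R j)) x + dist x z" by (rule dist_triangle)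
      also have "dist (x + s *\<^sub>R (\<sigma> *\<^sub>R j)) x = s" using s \<sigma> j by (simp add: dist_norm abs_mult)
      finally show ?thesis using s x by simp
    qed
    have D: "((\<lambda>s. \<phi> (x + s *\<^sub>R (\<sigma> *\<^sub>R j))) has_real_derivative
        pderiv_dir \<phi> j (x + s *\<^sub>R (\<sigma> *\<^sub>R j)) * \<sigma>) (at s)" if s: "0 \<le> s" "s \<le> t" for s
    proof -
      have "((\<lambda>s. \<phi> (x + s *\<^sub>R j)) has_real_derivative pderiv_dir \<phi> j (x + (s * \<sigma>) *\<^sub>R j)) (at (s * \<sigma>))"
        by (rule Ck_on_2_derivatives(1)[OF C2 U(1) j(1)]) (use rU in_r[OF s] in auto)
      moreover have "((\<lambda>s. s * \<sigma>) has_real_derivative \<sigma>) (at s)"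
        by (auto intro!: derivative_eq_intros)
      ultimately have "((\<lambda>s. \<phi> (x + (s * \<sigma>) *\<^sub>R j)) has_real_derivative
          pderiv_dir \<phi> j (x + (s * \<sigma>) *\<^sub>R j) * \<sigma>) (at s)"
        by (rule DERIV_chain2[where g="\<lambda>s. s * \<sigma>"])
      then show ?thesis by simp
    qed
    obtain \<xi> where \<xi>: "0 < \<xi>" "\<xi> < t" "\<phi> (x + t *\<^sub>R (\<sigma> *\<^sub>R j)) - \<phi> (x + 0 *\<^sub>R (\<sigma> *\<^sub>R j))
       = (t - 0) * (pderiv_dir \<phi> j (x + \<xi> *\<^sub>R (\<sigma> *\<^sub>R j)) * \<sigma>)"
      using MVT2[OF t D] by blast
    have "m < pderiv_dir \<phi> j (x + \<xi> *\<^sub>R (\<sigma> *\<^sub>R j)) * \<sigma>"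
      using rU[OF in_r[of \<xi>]] \<xi> by (simp add: mult.commute)
    then show ?thesis using \<xi>(3) t by (simp add: mult.commute)
  qed
  \<comment> \<open>The entry 1 yields \<rho> below 1, the range where \<open>Q\<close> is
    controlled; the entry \<open>r / 2\<close> keeps the outward walk inside the ball of radius
    \<open>r\<close> about \<open>z\<close>.\<close>
  have "eventually (\<lambda>x. - (m * min 1 (r / 2)) < \<phi> x) (nhds z)"
    by (rule eventually_nhds_isCont_gt[OF phi_cont[OF U(2)]]) (use m r phi_z in auto)
  then obtain r0 where "0 < r0" and r0: "\<And>x. dist x z < r0 \<Longrightarrow> - (m * min 1 (r / 2)) < \<phi> x"
    unfolding eventually_nhds_metric by blast
  define r1 where "r1 = min r0 (r / 2)"
  have r1: "0 < r1" "r1 \<le> r0" "r1 \<le> r / 2" using r \<open>0 < r0\<close> by (auto simp: r1_def)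
  \<comment> \<open>At distance \<open>r1 / 4\<close> from \<open>z\<close>, the ball of radius
    \<open>r1 / 2\<close> about \<open>y\<close> still contains \<open>z\<close>, and so meets
    \<Omega>, while its closure stays within \<open>r1\<close> of \<open>z\<close>.\<close>
  define y where "y = z + (r1 / 4) *\<^sub>R (\<sigma> *\<^sub>R j)"
  have dyz: "dist y z = r1 / 4" using r1 \<sigma> j by (simp add: y_def dist_norm abs_mult)
  have "0 < \<phi> y" using grow[of z "r1 / 4"] phi_z r1 r m
    by (simp add: y_def) (smt (verit) mult_pos_pos)
  moreover have "y \<in> U" using rU[of y] dyz r1 r by auto
  ultimately obtain \<eta> where \<eta>: "0 < \<eta>" "\<Omega> \<inter> ball y \<eta> = {}" using phi_pos_nhd by blast
  have near: "dist x z < r1" if "x \<in> cball y (r1 / 2)" for x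
    using that dist_triangle[of x z y] dyz r1 by (auto simp: dist_commute)
  show thesis
  proof (rule that[of U \<phi> y "r1 / 2" \<eta> "1 / m"])
    show "cball y (r1 / 2) \<subseteq> U" using near rU r1 r by (smt (verit) field_sum_of_halves subsetI)
    have "z \<in> ball y (r1 / 2)" using dyz r1 by simp
    then show "\<Omega> \<inter> ball y (r1 / 2) \<noteq> {}"
      using z_cl by (metis Int_commute disjoint_iff open_Int_closure_eq_empty open_ball)
    fix x assume x: "x \<in> \<Omega> \<inter> cball y (r1 / 2)"
    have xz: "dist x z < r1" using near x by auto
    have neg: "- \<phi> x < m * min 1 (r / 2)" using r0[of x] xz r1 by simp
    have "m * min 1 (r / 2) \<le> m * 1" "m * min 1 (r / 2) \<le> m * (r / 2)"
      using m by (auto intro!: mult_left_mono)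
    with neg have neg1: "- \<phi> x < m" "- \<phi> x < m * (r / 2)" by auto
    show "- (1 / m) * \<phi> x < 1" using neg1(1) m by (simp add: field_simps)
    have "x \<in> U" using rU[of x] xz r1 r by auto
    then have "\<phi> x < 0" using x mem by auto
    define t where "t = - \<phi> x / m"
    have t: "0 < t" "t < r / 2" "m * t = - \<phi> x"
      using \<open>\<phi> x < 0\<close> m neg1 by (auto simp: t_def field_simps)
    have dxt: "dist x z + t < r" using xz t r1 by auto
    have "0 < \<phi> (x + t *\<^sub>R (\<sigma> *\<^sub>R j))" using grow[OF dxt t(1)] t(3) by simp
    then have "x + t *\<^sub>R (\<sigma> *\<^sub>R j) \<notin> \<Omega>"
    proof -
      have "dist (x + t *\<^sub>R (\<sigma> *\<^sub>R j)) z < r"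
        using dxt dist_triangle[of "x + t *\<^sub>R (\<sigma> *\<^sub>R j)" z x] t \<sigma> j
        by (simp add: dist_norm abs_mult)
      then have "x + t *\<^sub>R (\<sigma> *\<^sub>R j) \<in> U" using rU by blast
      then show ?thesis using \<open>0 < \<phi> (x + t *\<^sub>R (\<sigma> *\<^sub>R j))\<close> mem by auto
    qed
    then have "infdist x (frontier \<Omega>) \<le> t"
      using x t \<sigma> j by (intro infdist_frontier_le[of _ _ _ "\<sigma> *\<^sub>R j"]) auto
    then show "infdist x (frontier \<Omega>) \<le> - (1 / m) * \<phi> x" by (simp add: t_def)
  qed (use U C2 \<Omega> \<eta> m in auto)
qed

section \<open>The second derivative test along one coordinate line\<close>

lemma comparison_second_derivative:
  fixes u0 u1 f0 f1 Q Q1 p :: "real \<Rightarrow> real"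
  assumes e: "0 < e"
    and u1: "\<And>t. \<bar>t\<bar> < e \<Longrightarrow> (u0 has_real_derivative u1 t) (at t)"
    and u2: "(u1 has_real_derivative u2) (at 0)"
    and f1: "\<And>t. \<bar>t\<bar> < e \<Longrightarrow> (f0 has_real_derivative f1 t) (at t)"
    and f2: "(f1 has_real_derivative f2) (at 0)"
    and rng: "\<And>t. \<bar>t\<bar> < e \<Longrightarrow> 0 < - c * f0 t \<and> - c * f0 t < 1"
    and Qd: "\<And>s. 0 < s \<Longrightarrow> s < 1 \<Longrightarrow> (Q has_real_derivative - Q1 s) (at s)"
    and Q1d: "\<And>s. 0 < s \<Longrightarrow> s < 1 \<Longrightarrow> (Q1 has_real_derivative - p s) (at s)"
    and min: "\<And>t. \<bar>t\<bar> < e \<Longrightarrow>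
        \<delta> * Q (- c * f0 0) - exp (- C * u0 0) - A * exp (- k * (a + 2 * b * 0 + 0\<^sup>2))
        \<le> \<delta> * Q (- c * f0 t) - exp (- C * u0 t) - A * exp (- k * (a + 2 * b * t + t\<^sup>2))"
  shows "0 \<le> C * exp (- C * u0 0) * (u2 - C * (u1 0)\<^sup>2)
      + \<delta> * (c\<^sup>2 * p (- c * f0 0) * (f1 0)\<^sup>2 + c * Q1 (- c * f0 0) * f2)
      + A * (2 * k - 4 * k\<^sup>2 * b\<^sup>2) * exp (- k * a)"
proof -
  \<comment> \<open>This is the comparison function of the main argument on a line, without its
    additive constants. The quadratic in \<open>t\<close> is the squared distance to
    \<open>y\<close>, with \<open>b\<close> the coordinate of the offset along the line.\<close>
  define f where "f t = \<delta> * Q (- c * f0 t) - exp (- C * u0 t) - A * exp (- k * (a + 2 * b * t + t\<^sup>2))" for t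
  define f' where "f' t = \<delta> * (c * Q1 (- c * f0 t) * f1 t) + C * (exp (- C * u0 t) * u1 t)
        + A * k * (2 * b + 2 * t) * exp (- k * (a + 2 * b * t + t\<^sup>2))" for t
  have cu: "((\<lambda>t. - C * u0 t) has_real_derivative - C * u1 t) (at t)" if "\<bar>t\<bar> < e" for t
    using u1[OF that] by (rule DERIV_cmult)
  have cf: "((\<lambda>t. - c * f0 t) has_real_derivative - c * f1 t) (at t)" if "\<bar>t\<bar> < e" for t
    using f1[OF that] by (rule DERIV_cmult)
  have Qf: "((\<lambda>t. Q (- c * f0 t)) has_real_derivative - Q1 (- c * f0 t) * (- c * f1 t)) (at t)"
    if "\<bar>t\<bar> < e" for t
    by (rule DERIV_chain2[where f=Q, OF Qd cf]) (use rng that in auto)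
  have Q1f: "((\<lambda>t. Q1 (- c * f0 t)) has_real_derivative - p (- c * f0 0) * (- c * f1 0)) (at 0)"
    by (rule DERIV_chain2[where f=Q1, OF Q1d cf]) (use rng[of 0] e in auto)
  have eu: "((\<lambda>t. exp (- C * u0 t)) has_real_derivative exp (- C * u0 t) * (- C * u1 t)) (at t)"
    if "\<bar>t\<bar> < e" for t
    by (rule DERIV_chain2[where f=exp, OF DERIV_exp cu[OF that]])
  have eq: "((\<lambda>t. exp (- k * (a + 2 * b * t + t\<^sup>2))) has_real_derivative
      exp (- k * (a + 2 * b * t + t\<^sup>2)) * (- k * (2 * b + 2 * t))) (at t)" for t
    by (auto intro!: derivative_eq_intros)
  have "(f has_real_derivative f' t) (at t)" if "\<bar>t\<bar> < e" for t
    unfolding f_def[abs_def]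
    by (rule DERIV_cong[OF DERIV_diff[OF DERIV_diff[OF DERIV_cmult[OF Qf] eu] DERIV_cmult[OF eq]]])
       (use that in \<open>simp_all add: f'_def algebra_simps\<close>)
  moreover have "(f' has_real_derivative
      C * exp (- C * u0 0) * (u2 - C * (u1 0)\<^sup>2)
      + \<delta> * (c\<^sup>2 * p (- c * f0 0) * (f1 0)\<^sup>2 + c * Q1 (- c * f0 0) * f2)
      + A * (2 * k - 4 * k\<^sup>2 * b\<^sup>2) * exp (- k * a)) (at 0)"
  proof -
    have lin: "((\<lambda>t. A * k * (2 * b + 2 * t)) has_real_derivative A * k * 2) (at 0)"
      by (auto intro!: derivative_eq_intros)
    show ?thesis
      unfolding f'_def[abs_def]
      by (rule DERIV_cong[OF DERIV_add[OF DERIV_add[OF DERIV_cmult[OF DERIV_mult[OF DERIV_cmult[OF Q1f] f2]]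
          DERIV_cmult[OF DERIV_mult[OF eu u2]]] DERIV_mult[OF lin eq]]])
         (use e in \<open>simp_all add: algebra_simps power2_eq_square\<close>)
  qed
  moreover have "f 0 \<le> f t" if "\<bar>t\<bar> < e" for t
    unfolding f_def by (rule min[OF that])
  ultimately show ?thesis
    by (rule second_deriv_nonneg_at_min[OF e])
qed

section \<open>Setting up the comparison on a ball\<close>

theorem theorem3p1:
  fixes \<Omega> :: "'a::euclidean_space set"
    and g p :: "real \<Rightarrow> real" and C :: real
  assumes dim: "DIM('a) \<ge> 2"
    and dom: "bounded_domain \<Omega>" and bdry: "smooth_boundary \<Omega>"
    and g_C1: "g C1_differentiable_on {0<..}"
    and g_pos: "\<forall>t>0. g t > 0"
    and g_dec: "\<forall>s t. 0 < s \<longrightarrow> s \<le> t \<longrightarrow> g t \<le> g s"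
    and g_lim: "filterlim g at_top (at_right 0)"
    and p_pos: "\<forall>t>0. p t > 0"
    and p_dec: "\<forall>s t. 0 < s \<longrightarrow> s \<le> t \<longrightarrow> p t \<le> p s"
    and p_hol: "loc_holder_pos p"
    and p_int: "(\<integral>\<^sup>+ t. ennreal (t * p t) * indicator {0<..1} t \<partial>lborel) = \<infinity>"
  shows "\<not> (\<exists>u :: 'a \<Rightarrow> real.
            Ck_on 2 \<Omega> u \<and> continuous_on (closure \<Omega>) u \<and>
            (\<forall>x\<in>\<Omega>. u x > 0) \<and> (\<forall>x\<in>frontier \<Omega>. u x = 0) \<and>
            (\<forall>x\<in>\<Omega>. - laplacian u x + C * (norm (grad u x))\<^sup>2
                        \<ge> p (infdist x (frontier \<Omega>)) * g (u x)))"
proof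
  assume "\<exists>u :: 'a \<Rightarrow> real.
            Ck_on 2 \<Omega> u \<and> continuous_on (closure \<Omega>) u \<and>
            (\<forall>x\<in>\<Omega>. u x > 0) \<and> (\<forall>x\<in>frontier \<Omega>. u x = 0) \<and>
            (\<forall>x\<in>\<Omega>. - laplacian u x + C * (norm (grad u x))\<^sup>2
                        \<ge> p (infdist x (frontier \<Omega>)) * g (u x))"
  then obtain u :: "'a \<Rightarrow> real" where u_C2: "Ck_on 2 \<Omega> u" and u_cont: "continuous_on (closure \<Omega>) u"
    and u_pos: "\<And>x. x \<in> \<Omega> \<Longrightarrow> u x > 0"
    and u_pde: "\<And>x. x \<in> \<Omega> \<Longrightarrow> - laplacian u x + C * (norm (grad u x))\<^sup>2
                        \<ge> p (infdist x (frontier \<Omega>)) * g (u x)"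
    by blast
  have ne: "\<Omega> \<noteq> {}" and op: "open \<Omega>" and bd: "bounded \<Omega>"
    using dom by (auto simp: bounded_domain_def)
  have "frontier \<Omega> \<noteq> {}"
    using ne bd by (metis frontier_eq_empty not_bounded_UNIV)
  then obtain z where z: "z \<in> frontier \<Omega>" by blast
  obtain U \<phi> c y R \<eta> where U: "open U" and \<phi>_C2: "Ck_on 2 U \<phi>"
    and \<Omega>U: "\<Omega> \<inter> U = {x \<in> U. \<phi> x < 0}" and yU: "cball y R \<subseteq> U"
    and yne: "\<Omega> \<inter> ball y R \<noteq> {}" and \<eta>: "0 < \<eta>" "\<Omega> \<inter> ball y \<eta> = {}" and c: "0 < c"
    and \<rho>_less: "\<And>x. x \<in> \<Omega> \<inter> cball y R \<Longrightarrow> - c * \<phi> x < 1"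
    and \<rho>_ge: "\<And>x. x \<in> \<Omega> \<inter> cball y R \<Longrightarrow> infdist x (frontier \<Omega>) \<le> - c * \<phi> x"
    by (rule local_boundary_function[OF op bdry z]) (rule that; assumption)
  have mem: "x \<in> \<Omega> \<longleftrightarrow> \<phi> x < 0" if "x \<in> U" for x
    using \<Omega>U that by blast
  obtain Q Q1 where Qd: "\<And>s. 0 < s \<Longrightarrow> s < 1 \<Longrightarrow> (Q has_real_derivative - Q1 s) (at s)"
    and Q1d: "\<And>s. 0 < s \<Longrightarrow> s < 1 \<Longrightarrow> (Q1 has_real_derivative - p s) (at s)"
    and Q_nonneg: "\<And>s. 0 < s \<Longrightarrow> s < 1 \<Longrightarrow> 0 \<le> Q s"
    and Q1_nonneg: "\<And>s. 0 < s \<Longrightarrow> s < 1 \<Longrightarrow> 0 \<le> Q1 s"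
    and Q1_le: "\<And>s. 0 < s \<Longrightarrow> s < 1 \<Longrightarrow> Q1 s \<le> 2 * p s"
    and Q_large: "\<And>B e. 0 < e \<Longrightarrow> \<exists>s. 0 < s \<and> s < e \<and> s < 1 \<and> B \<le> Q s"
    by (rule blowup_function[of p, OF _ _ continuous_on_loc_holder_pos[OF p_hol] p_int,
          OF p_pos[rule_format] p_dec[rule_format]])
       (assumption | rule that)+

  define C' where "C' = max C 1"
  have C': "C' > 0" "C \<le> C'" by (auto simp: C'_def)
  \<comment> \<open>The upper bound on \<open>u\<close> gives the positive lower bounds
    \<open>exp (- C' * M)\<close> and \<open>g M\<close> for the factors in the transformed
    inequality.\<close>
  obtain M where M: "\<And>x. x \<in> \<Omega> \<Longrightarrow> u x \<le> M"
  proof -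
    have "compact (u ` closure \<Omega>)" using bd by (intro compact_continuous_image u_cont) simp
    then have "bdd_above (u ` closure \<Omega>)"
      by (intro bounded_imp_bdd_above compact_imp_bounded)
    then obtain M where "\<And>x. x \<in> closure \<Omega> \<Longrightarrow> u x \<le> M"
      unfolding bdd_above_def by blast
    then show ?thesis using that closure_subset by blast
  qed
  have M_pos: "M > 0" using ne u_pos M by (meson all_not_in_conv less_le_trans)
  have \<phi>_cont: "continuous_on (cball y R) \<phi>"
    "\<And>i. i \<in> Basis \<Longrightarrow> continuous_on (cball y R) (pderiv_dir \<phi> i)"
    "\<And>i. i \<in> Basis \<Longrightarrow> continuous_on (cball y R) (pderiv_dir (pderiv_dir \<phi> i) i)"
    using Ck_on_2_continuous[OF \<phi>_C2] yU SOME_Basis by (blast intro: continuous_on_subset)+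
  obtain G where G: "\<And>x. x \<in> cball y R \<Longrightarrow> (norm (grad \<phi> x))\<^sup>2 \<le> G"
  proof -
    have "continuous_on (cball y R) (\<lambda>x. (norm (grad \<phi> x))\<^sup>2)"
      unfolding norm_grad_squared by (intro continuous_intros \<phi>_cont)
    then have "bdd_above ((\<lambda>x. (norm (grad \<phi> x))\<^sup>2) ` cball y R)"
      by (intro bounded_imp_bdd_above compact_imp_bounded compact_continuous_image) auto
    then show ?thesis using that unfolding bdd_above_def by blast
  qed
  obtain L where L: "\<And>x. x \<in> cball y R \<Longrightarrow> laplacian \<phi> x \<le> L"
  proof -
    have "continuous_on (cball y R) (laplacian \<phi>)"
      unfolding laplacian_def by (intro continuous_intros \<phi>_cont)
    then have "bdd_above (laplacian \<phi> ` cball y R)"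
      by (intro bounded_imp_bdd_above compact_imp_bounded compact_continuous_image) auto
    then show ?thesis using that unfolding bdd_above_def by blast
  qed
  have gM: "0 < g M" using g_pos M_pos by blast
  \<comment> \<open>\<open>T * p\<close> bounds the Laplacian of \<open>Q\<close> composed with
    \<rho>: the first term covers the squared gradient of \<phi>, the second its Laplacian through
    \<open>Q1_le\<close>, and 1 keeps \<open>T\<close> positive. Then \<delta> makes
    \<open>\<delta> * T\<close> equal to the constant gained from the differential
    inequality.\<close>
  define T where "T = c\<^sup>2 * \<bar>G\<bar> + c * 2 * \<bar>L\<bar> + 1"
  have T: "T > 0" using c unfolding T_def by (intro add_nonneg_pos add_nonneg_nonneg mult_nonneg_nonneg) auto
  define \<delta> where "\<delta> = C' * exp (- C' * M) * g M / T"
  have \<delta>: "\<delta> > 0" using C' T gM by (simp add: \<delta>_def)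
  \<comment> \<open>The Laplacian of \<open>exp (- k * r\<^sup>2)\<close>, with \<open>r\<close> the
    distance to \<open>y\<close>, has the sign of \<open>2 * k * r\<^sup>2 - DIM('a)\<close>. This
    choice makes it positive for \<open>r \<ge> \<eta>\<close>, hence throughout \<Omega>.\<close>
  define k where "k = DIM('a) / \<eta>\<^sup>2"
  have k: "k > 0" using \<eta> by (auto simp: k_def)
  define h where "h x = exp (- k * (norm (x - y))\<^sup>2) - exp (- k * R\<^sup>2)" for x
  have h_le: "h x \<le> 1" for x
  proof -
    have "exp (- k * (norm (x - y))\<^sup>2) \<le> 1" using k by simp
    then show ?thesis using exp_gt_zero[of "- k * R\<^sup>2"] unfolding h_def by linarith
  qed
  obtain x1 where x1: "x1 \<in> \<Omega>" "x1 \<in> ball y R" using yne by blast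
  have "(norm (x1 - y))\<^sup>2 < R\<^sup>2"
    using x1(2) by (intro power_strict_mono) (auto simp: dist_norm norm_minus_commute)
  then have h1: "h x1 > 0" using k by (auto simp: h_def)
  have x1U: "x1 \<in> U" using x1 yU ball_subset_cball by blast
  have \<rho>1: "0 < - c * \<phi> x1" "- c * \<phi> x1 < 1"
    using x1 mem[OF x1U] c \<rho>_less[of x1] by (auto simp: mult_pos_neg)
  define V where "V x = 1 - exp (- C' * u x) + \<delta> * Q (- c * \<phi> x)" for x
  have V_ge: "\<delta> * Q (- c * \<phi> x) \<le> V x" if "x \<in> \<Omega>" for x
    using u_pos[OF that] C' by (simp add: V_def)
  have V1: "0 \<le> V x1"
    using V_ge[OF x1(1)] \<delta> Q_nonneg[OF \<rho>1] by (meson less_imp_le mult_nonneg_nonneg order_trans)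
  \<comment> \<open>Chosen so that \<open>F x1 = - 1\<close>.\<close>
  define A where "A = (V x1 + 1) / h x1"
  have A: "A > 0" using V1 h1 by (auto simp: A_def)
  define F where "F x = V x - A * h x" for x
  have F1: "F x1 < 0" using h1 by (simp add: F_def A_def)
  \<comment> \<open>The level lies below \<rho> at \<open>x1\<close>, so that \<open>x1\<close>
    survives the truncation, and is so small that \<open>\<delta> * Q s\<close> already reaches
    \<open>A\<close>, the largest possible value of \<open>A * h\<close>.\<close>
  obtain s where s: "0 < s" "s < - c * \<phi> x1" "s < 1" "A / \<delta> \<le> Q s"
    using Q_large[OF \<rho>1(1)] by blast
  \<comment> \<open>Truncating at \<rho> at least \<open>s\<close> gives a compact set inside
    \<Omega>, where \<open>F\<close> is continuous and attains its minimum.\<close>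
  define D where "D = cball y R \<inter> \<phi> -` {.. - s / c}"
  have DU: "x \<in> U" if "x \<in> D" for x using that yU by (auto simp: D_def)
  have D\<Omega>: "x \<in> \<Omega>" if "x \<in> D" for x
  proof -
    have "\<phi> x \<le> - s / c" "- s / c < 0" using that s c by (auto simp: D_def)
    then show ?thesis using mem[OF DU[OF that]] by linarith
  qed
  have D\<rho>: "s \<le> - c * \<phi> x" "- c * \<phi> x < 1" if "x \<in> D" for x
    using that c \<rho>_less[of x] D\<Omega>[OF that] by (auto simp: D_def field_simps)
  have "compact D"
  proof -
    have "closed D"
      unfolding D_def by (rule continuous_closed_preimage[OF \<phi>_cont(1)]) auto
    then show ?thesis
      using compact_cball[of y R] compact_Int_closed[of "cball y R" D] by (auto simp: D_def Int_absorb1)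
  qed
  have "x1 \<in> D" using x1 s c by (auto simp: D_def field_simps)
  have "continuous_on D F"
  proof -
    have Qc: "continuous_on {0<..<1} Q"
      by (intro continuous_at_imp_continuous_on ballI DERIV_isCont[OF Qd]) auto
    have "continuous_on D \<phi>" using \<phi>_cont(1) by (rule continuous_on_subset) (auto simp: D_def)
    moreover have "continuous_on D u"
      using Ck_on_2_continuous(1)[OF u_C2 SOME_Basis] D\<Omega> by (blast intro: continuous_on_subset)
    moreover have "(\<lambda>x. - c * \<phi> x) ` D \<subseteq> {0<..<1}" using D\<rho> s by force
    ultimately show ?thesis
      unfolding F_def V_def h_def
      by (intro continuous_intros continuous_on_compose2[OF Qc]) auto
  qed
  then obtain x0 where x0: "x0 \<in> D" and x0_min: "\<And>x. x \<in> D \<Longrightarrow> F x0 \<le> F x"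
    using continuous_attains_inf[OF \<open>compact D\<close>] \<open>x1 \<in> D\<close> by blast
  have F0: "F x0 < 0" using x0_min[OF \<open>x1 \<in> D\<close>] F1 by simp
  have x0\<Omega>: "x0 \<in> \<Omega>" using D\<Omega>[OF x0] .
  have \<rho>0: "0 < - c * \<phi> x0" "- c * \<phi> x0 < 1" using D\<rho>[OF x0] s by auto
  \<comment> \<open>\<open>F\<close> is nonnegative on both parts of the edge of \<open>D\<close>:
    on the sphere because \<open>h\<close> vanishes, on the level set because \<open>Q\<close> is
    large. A negative minimum is therefore interior.\<close>
  have in_ball: "x0 \<in> ball y R"
  proof (rule ccontr)
    assume "x0 \<notin> ball y R"
    then have "norm (x0 - y) = R"
      using x0 by (auto simp: D_def dist_norm norm_minus_commute)
    then have "h x0 = 0" by (simp add: h_def)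
    then have "F x0 = V x0" by (simp add: F_def)
    moreover have "0 \<le> \<delta> * Q (- c * \<phi> x0)" using \<delta> Q_nonneg[OF \<rho>0] by simp
    ultimately show False using F0 V_ge[OF x0\<Omega>] by linarith
  qed
  have in_level: "\<phi> x0 < - s / c"
  proof (rule ccontr)
    assume "\<not> ?thesis"
    then have "\<phi> x0 = - s / c" using x0 by (auto simp: D_def)
    then have "- c * \<phi> x0 = s" using c by simp
    then have "\<delta> * Q s \<le> V x0" using V_ge[OF x0\<Omega>] by simp
    moreover have "A \<le> \<delta> * Q s" using s(4) \<delta> by (simp add: field_simps)
    moreover have "A * h x0 \<le> A" using A h_le[of x0] by (simp add: mult_left_le)
    ultimately show False using F0 by (simp add: F_def)
  qed
  obtain e where e: "0 < e" "ball x0 e \<subseteq> D"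
  proof -
    have "continuous_on (ball y R) \<phi>"
      using \<phi>_cont(1) ball_subset_cball by (rule continuous_on_subset)
    then have "open (ball y R \<inter> \<phi> -` {..< - s / c})"
      by (rule continuous_open_preimage) auto
    then obtain e where "0 < e" "ball x0 e \<subseteq> ball y R \<inter> \<phi> -` {..< - s / c}"
      using in_ball in_level openE[of "ball y R \<inter> \<phi> -` {..< - s / c}" x0] by auto
    moreover have "ball y R \<inter> \<phi> -` {..< - s / c} \<subseteq> D" by (auto simp: D_def)
    ultimately show ?thesis using that by blast
  qed

  \<comment> \<open>Second-order conditions at the minimum and the contradiction\<close>
  define a where "a = (norm (x0 - y))\<^sup>2"
  define E where "E = C' * exp (- C' * u x0)"
  define P where "P = p (- c * \<phi> x0)"
  have step: "0 \<le> E * (pderiv_dir (pderiv_dir u i) i x0 - C' * (pderiv_dir u i x0)\<^sup>2)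
      + \<delta> * (c\<^sup>2 * P * (pderiv_dir \<phi> i x0)\<^sup>2
              + c * Q1 (- c * \<phi> x0) * pderiv_dir (pderiv_dir \<phi> i) i x0)
      + A * (2 * k - 4 * k\<^sup>2 * ((x0 - y) \<bullet> i)\<^sup>2) * exp (- k * a)"
    if i: "i \<in> Basis" for i
  proof -
    have inD: "x0 + t *\<^sub>R i \<in> D" if "\<bar>t\<bar> < e" for t
      using e(2) that i by (auto simp: dist_norm subset_iff)
    have sq: "(norm (x0 + t *\<^sub>R i - y))\<^sup>2 = a + 2 * ((x0 - y) \<bullet> i) * t + t\<^sup>2" for t
    proof -
      have "x0 + t *\<^sub>R i - y = (x0 - y) + t *\<^sub>R i" by simp
      then show ?thesis using i
        by (simp only: a_def power2_norm_eq_inner)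
           (simp add: inner_add_left inner_add_right inner_commute power2_eq_square)
    qed
    note u_d = Ck_on_2_derivatives[OF u_C2 op i]
    note \<phi>_d = Ck_on_2_derivatives[OF \<phi>_C2 U i]
    have x0U: "x0 \<in> U" using DU[OF x0] .
    have "0 \<le> C' * exp (- C' * u (x0 + 0 *\<^sub>R i)) *
          (pderiv_dir (pderiv_dir u i) i x0 - C' * (pderiv_dir u i (x0 + 0 *\<^sub>R i))\<^sup>2)
      + \<delta> * (c\<^sup>2 * p (- c * \<phi> (x0 + 0 *\<^sub>R i)) * (pderiv_dir \<phi> i (x0 + 0 *\<^sub>R i))\<^sup>2
              + c * Q1 (- c * \<phi> (x0 + 0 *\<^sub>R i)) * pderiv_dir (pderiv_dir \<phi> i) i x0)
      + A * (2 * k - 4 * k\<^sup>2 * ((x0 - y) \<bullet> i)\<^sup>2) * exp (- k * a)"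
    proof (rule comparison_second_derivative[where e=e and Q=Q and ?Q1.0=Q1 and p=p
          and ?u0.0="\<lambda>t. u (x0 + t *\<^sub>R i)" and ?u1.0="\<lambda>t. pderiv_dir u i (x0 + t *\<^sub>R i)"
          and ?f0.0="\<lambda>t. \<phi> (x0 + t *\<^sub>R i)" and ?f1.0="\<lambda>t. pderiv_dir \<phi> i (x0 + t *\<^sub>R i)"])
      fix t assume t: "\<bar>t\<bar> < e"
      show "0 < - c * \<phi> (x0 + t *\<^sub>R i) \<and> - c * \<phi> (x0 + t *\<^sub>R i) < 1"
        using D\<rho>[OF inD[OF t]] s by auto
      have "F x0 \<le> F (x0 + t *\<^sub>R i)" by (rule x0_min[OF inD[OF t]])
      then show "\<delta> * Q (- c * \<phi> (x0 + 0 *\<^sub>R i)) - exp (- C' * u (x0 + 0 *\<^sub>R i))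
          - A * exp (- k * (a + 2 * ((x0 - y) \<bullet> i) * 0 + 0\<^sup>2))
        \<le> \<delta> * Q (- c * \<phi> (x0 + t *\<^sub>R i)) - exp (- C' * u (x0 + t *\<^sub>R i))
          - A * exp (- k * (a + 2 * ((x0 - y) \<bullet> i) * t + t\<^sup>2))"
        unfolding F_def V_def h_def sq[symmetric] by (simp add: right_diff_distrib)
    qed (use e(1) u_d[of x0] \<phi>_d[of x0] inD D\<Omega> DU x0\<Omega> x0U u_d(2)[of x0 0] \<phi>_d(2)[of x0 0] Qd Q1d in auto)
    then show ?thesis by (simp add: E_def P_def)
  qed
  have sum_sq: "(\<Sum>i\<in>Basis. ((x0 - y) \<bullet> i)\<^sup>2) = a"
    unfolding a_def power2_norm_eq_inner by (subst euclidean_inner) (simp add: power2_eq_square)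
  \<comment> \<open>Summing over the axes turns the one-dimensional tests into Laplacians and
    squared gradients.\<close>
  have "0 \<le> (\<Sum>i\<in>Basis. E * (pderiv_dir (pderiv_dir u i) i x0 - C' * (pderiv_dir u i x0)\<^sup>2)
      + \<delta> * (c\<^sup>2 * P * (pderiv_dir \<phi> i x0)\<^sup>2
              + c * Q1 (- c * \<phi> x0) * pderiv_dir (pderiv_dir \<phi> i) i x0)
      + A * (2 * k - 4 * k\<^sup>2 * ((x0 - y) \<bullet> i)\<^sup>2) * exp (- k * a))"
    by (rule sum_nonneg) (rule step)
  also have "\<dots> = E * (laplacian u x0 - C' * (norm (grad u x0))\<^sup>2)
      + \<delta> * (c\<^sup>2 * P * (norm (grad \<phi> x0))\<^sup>2 + c * Q1 (- c * \<phi> x0) * laplacian \<phi> x0)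
      + A * (2 * k * DIM('a) - 4 * k\<^sup>2 * a) * exp (- k * a)"
    unfolding norm_grad_squared laplacian_def sum_sq[symmetric]
    by (simp only: sum.distrib sum_subtractf sum_distrib_left sum_distrib_right distrib_left
        right_diff_distrib left_diff_distrib sum_constant) (simp add: mult_ac)
  finally have total: "0 \<le> E * (laplacian u x0 - C' * (norm (grad u x0))\<^sup>2)
      + \<delta> * (c\<^sup>2 * P * (norm (grad \<phi> x0))\<^sup>2 + c * Q1 (- c * \<phi> x0) * laplacian \<phi> x0)
      + A * (2 * k * DIM('a) - 4 * k\<^sup>2 * a) * exp (- k * a)" .

  have P: "P > 0" using p_pos \<rho>0 by (auto simp: P_def)
  have "E * (laplacian u x0 - C' * (norm (grad u x0))\<^sup>2) \<le> - (\<delta> * T * P)"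
  proof -
    \<comment> \<open>Monotonicity of \<open>p\<close> is available only at positive arguments, so
      the distance to the boundary must first be seen to be positive.\<close>
    have "x0 \<notin> frontier \<Omega>" using x0\<Omega> op by (simp add: frontier_def interior_open)
    then have "0 < infdist x0 (frontier \<Omega>)"
      using z by (intro infdist_pos_not_in_closed) auto
    moreover have "infdist x0 (frontier \<Omega>) \<le> - c * \<phi> x0"
      using \<rho>_ge[of x0] x0 x0\<Omega> by (auto simp: D_def)
    ultimately have "P \<le> p (infdist x0 (frontier \<Omega>))" using p_dec by (simp add: P_def)
    moreover have "g M \<le> g (u x0)" using g_dec u_pos M x0\<Omega> by blast
    ultimately have "P * g M \<le> p (infdist x0 (frontier \<Omega>)) * g (u x0)"
      using P less_imp_le[OF gM] by (intro mult_mono) linarith+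
    also have "\<dots> \<le> - laplacian u x0 + C * (norm (grad u x0))\<^sup>2" by (rule u_pde[OF x0\<Omega>])
    also have "\<dots> \<le> - laplacian u x0 + C' * (norm (grad u x0))\<^sup>2"
      using C' by (intro add_left_mono mult_right_mono) auto
    finally have 1: "P * g M \<le> - (laplacian u x0 - C' * (norm (grad u x0))\<^sup>2)" by simp
    have "C' * exp (- C' * M) \<le> E"
      using C' M[OF x0\<Omega>] by (simp add: E_def)
    then have "C' * exp (- C' * M) * (P * g M) \<le> E * - (laplacian u x0 - C' * (norm (grad u x0))\<^sup>2)"
    proof (rule mult_mono[OF _ 1])
      show "0 \<le> E" using C' by (simp add: E_def)
      show "0 \<le> P * g M" using P gM by simp
    qed
    moreover have "C' * exp (- C' * M) * (P * g M) = \<delta> * T * P"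
      using T by (simp add: \<delta>_def)
    ultimately show ?thesis unfolding mult_minus_right by linarith
  qed
  \<comment> \<open>The barrier costs at most \<open>\<delta> * T * P\<close>, exactly what the
    differential inequality supplies; strictness must come from the exponential term.\<close>
  moreover have "\<delta> * (c\<^sup>2 * P * (norm (grad \<phi> x0))\<^sup>2 + c * Q1 (- c * \<phi> x0) * laplacian \<phi> x0)
      \<le> \<delta> * (T * P)"
  proof (rule mult_left_mono)
    have x0c: "x0 \<in> cball y R" using x0 by (simp add: D_def)
    have "c\<^sup>2 * P * (norm (grad \<phi> x0))\<^sup>2 \<le> c\<^sup>2 * P * \<bar>G\<bar>"
      using G[OF x0c] P by (intro mult_left_mono) auto
    moreover have "c * Q1 (- c * \<phi> x0) * laplacian \<phi> x0 \<le> c * (2 * P) * \<bar>L\<bar>"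
    proof -
      have "c * Q1 (- c * \<phi> x0) * laplacian \<phi> x0 \<le> c * Q1 (- c * \<phi> x0) * \<bar>L\<bar>"
        using L[OF x0c] c Q1_nonneg[OF \<rho>0] by (intro mult_left_mono) auto
      also have "\<dots> \<le> c * (2 * P) * \<bar>L\<bar>"
        using c Q1_le[OF \<rho>0] by (intro mult_right_mono mult_left_mono) (auto simp: P_def)
      finally show ?thesis .
    qed
    moreover have "T * P = c\<^sup>2 * P * \<bar>G\<bar> + c * (2 * P) * \<bar>L\<bar> + P"
      by (simp add: T_def algebra_simps)
    ultimately show "c\<^sup>2 * P * (norm (grad \<phi> x0))\<^sup>2 + c * Q1 (- c * \<phi> x0) * laplacian \<phi> x0 \<le> T * P"
      using P by linarith
  qed (use \<delta> in auto)
  \<comment> \<open>\<open>x0\<close> lies outside the ball of radius \<eta> about \<open>y\<close>,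
    so \<open>k * a\<close> is at least the dimension and its double exceeds it strictly.\<close>
  moreover have "A * (2 * k * DIM('a) - 4 * k\<^sup>2 * a) * exp (- k * a) < 0"
  proof -
    have "x0 \<notin> ball y \<eta>" using \<eta>(2) x0\<Omega> by blast
    then have "\<eta>\<^sup>2 \<le> a"
      unfolding a_def using \<eta>(1) by (intro power_mono) (auto simp: dist_norm norm_minus_commute)
    then have "k * \<eta>\<^sup>2 \<le> k * a" using k by simp
    then have "DIM('a) \<le> k * a" using \<eta>(1) by (simp add: k_def)
    then have "real DIM('a) < 2 * (k * a)" using DIM_positive[where 'a='a] by linarith
    then have "2 * k * DIM('a) < 2 * k * (2 * (k * a))" using k by (intro mult_strict_left_mono) auto
    then have "2 * k * DIM('a) - 4 * k\<^sup>2 * a < 0" by (simp add: power2_eq_square algebra_simps)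
    then show ?thesis using A by (simp add: mult_pos_neg mult_neg_pos)
  qed
  ultimately show False using total unfolding mult.assoc[of \<delta> T P] by linarith
qed

end
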